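(* Let $1\le p\le\infty$ and let $\{X_t\}_{t\in(0,T)}$ be a monotone family of Banach spaces such that every $X_t$ is reflexive. If $u\in W^{1,p}((0,T);\{X_t\})$, then there exists a section $v\in L^p((0,T);\{X_t\})$ such that the function $t\mapsto\|v(t)\|_t$ is a $p$-integrable upper gradient of $u$ and $$\|v\|_{L^p((0,T);\{X_t\})}=\inf_{g}\|g\|_{L^p((0,T))},$$ where the infimum is taken over all $p$-integrable upper gradients $g$ of $u$.
   Context: Monotone Banach family: let $0<T\le\infty$ and let $(0,T)$ carry Lebesgue measure. Let $V$ be a real vector space and $\{\|\cdot\|_t\}_{t\in(0,T)}$ a family of semi-norms on $V$ such that for each $v\in V$ the function $t\mapsto N(t,v)=\|v\|_t$ is non-increasing. $X_t$ denotes the Banach space obtained by completing $V/\ker(\|\cdot\|_t)$ with respect to $\|\cdot\|_t$; $\{X_t\}_{t\in(0,T)}$ is called a monotone family of Banach spaces. For $s\le t$ the operator $P(s,t):X_s\to X_t$ is defined as follows: if $x\in X_s$ is the limit in $X_s$ of a sequence $\{v_k\}\subset V$ that is Cauchy for $\|\cdot\|_s$, then $\{v_k\}$ is Cauchy for $\|\cdot\|_t$ and $P(s,t)x$ is its limit in $X_t$. Sections: a section is a map $f:(0,T)\to\bigcup_t X_t$ with $f(t)\in X_t$ for each $t$. A simple section is one of the form $f(t)=\sum_{k=1}^n\chi_{A_k}(t)v_k$ with $v_k\in V$ and $A_k\subset(0,T)$ measurable ($v_k$ being viewed in $X_t$). A section $f$ is measurable if there are simple sections $f_k$ with $f_k(t)\to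 f(t)$ in $X_t$ for almost all $t$. Measurable sections equal a.e. are identified. For $1\le p\le\infty$, $L^p((0,T);\{X_t\})$ is the space of measurable sections $f$ such that $t\mapsto\|f(t)\|_t$ belongs to $L^p((0,T))$, with norm $\|f\|_{L^p((0,T);\{X_t\})}$ equal to the $L^p((0,T))$-norm of $t\mapsto\|f(t)\|_t$. Sobolev space: a measurable section $u$ is in $W^{1,p}((0,T);\{X_t\})$ if $u\in L^p((0,T);\{X_t\})$ and there exists $g\in L^p((0,T))$ such that $$\|u(t)-P(s,t)u(s)\|_t\le\int_s^t g(\tau)\,d\tau\quad\text{for almost all } s,t\in(0,T),\ s\le t.$$ Any such $g$ is called a $p$-integrable upper gradient of $u$. *)

theory Defs
  imports "HOL-Analysis.Analysis" "HOL-Probability.Essential_Supremum"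
begin

section \<open>Normed spaces on a carrier set\<close>

text \<open>
  The spaces \<open>X\<^sub>t\<close> vary with \<open>t\<close>, so they cannot be types of class \<^class>\<open>real_normed_vector\<close>;
  all of them are carrier sets inside one type.
\<close>

record 'a nspace =
  points :: "'a set"
  nadd :: "'a \<Rightarrow> 'a \<Rightarrow> 'a"
  nscale :: "real \<Rightarrow> 'a \<Rightarrow> 'a"
  nrm :: "'a \<Rightarrow> real"

definition nsub :: "'a nspace \<Rightarrow> 'a \<Rightarrow> 'a \<Rightarrow> 'a" where
  "nsub X x y = nadd X x (nscale X (-1) y)"

text \<open>
  Functionals are \<^const>\<open>extensional\<close>, so that equality in the dual is equality on the carrier.
\<close>

definition dual :: "'a nspace \<Rightarrow> ('a \<Rightarrow> real) nspace" where
  "dual X = \<lparr>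
     points = {\<phi> \<in> extensional (points X).
       (\<forall>x\<in>points X. \<forall>y\<in>points X. \<phi> (nadd X x y) = \<phi> x + \<phi> y) \<and>
       (\<forall>c. \<forall>x\<in>points X. \<phi> (nscale X c x) = c * \<phi> x) \<and>
       (\<exists>C. \<forall>x\<in>points X. \<bar>\<phi> x\<bar> \<le> C * nrm X x)},
     nadd = (\<lambda>\<phi> \<psi>. restrict (\<lambda>x. \<phi> x + \<psi> x) (points X)),
     nscale = (\<lambda>c \<phi>. restrict (\<lambda>x. c * \<phi> x) (points X)),
     nrm = (\<lambda>\<phi>. SUP x\<in>{x \<in> points X. nrm X x \<le> 1}. \<bar>\<phi> x\<bar>)\<rparr>"

definition reflexive :: "'a nspace \<Rightarrow> bool" where
  "reflexive X \<longleftrightarrow>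
     (\<forall>\<Phi>\<in>points (dual (dual X)). \<exists>x\<in>points X. \<forall>\<phi>\<in>points (dual X). \<Phi> \<phi> = \<phi> x)"

section \<open>Completion of a semi-normed space\<close>

definition seminorm :: "('v::real_vector \<Rightarrow> real) \<Rightarrow> bool" where
  "seminorm N \<longleftrightarrow> (\<forall>x. 0 \<le> N x) \<and> (\<forall>x y. N (x + y) \<le> N x + N y) \<and>
     (\<forall>c x. N (c *\<^sub>R x) = \<bar>c\<bar> * N x)"

definition Cauchy_seqs :: "('v::real_vector \<Rightarrow> real) \<Rightarrow> (nat \<Rightarrow> 'v) set" where
  "Cauchy_seqs N = {x. \<forall>e>0. \<exists>M. \<forall>m\<ge>M. \<forall>n\<ge>M. N (x m - x n) < e}"

definition null_rel :: "('v::real_vector \<Rightarrow> real) \<Rightarrow> ((nat \<Rightarrow> 'v) \<times> (nat \<Rightarrow> 'v)) set" where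
  "null_rel N = {(x, y). x \<in> Cauchy_seqs N \<and> y \<in> Cauchy_seqs N \<and>
     (\<lambda>k. N (x k - y k)) \<longlonglongrightarrow> 0}"

text \<open>
  The Banach space completion of \<open>V / ker N\<close>: Cauchy sequences modulo null sequences. Sequences in
  \<open>V\<close> can be used in place of sequences in \<open>V / ker N\<close>, since \<^const>\<open>null_rel\<close> identifies sequences
  whose terms differ by elements of \<open>ker N\<close>. A point is thus the set of all Cauchy sequences in
  \<open>V\<close> converging to it.
\<close>

definition seminorm_completion :: "('v::real_vector \<Rightarrow> real) \<Rightarrow> (nat \<Rightarrow> 'v) set nspace" where
  "seminorm_completion N = \<lparr>
     points = Cauchy_seqs N // null_rel N,
     nadd = (\<lambda>a b. null_rel N `` {\<lambda>k. x k + y k | x y. x \<in> a \<and> y \<in> b}),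
     nscale = (\<lambda>c a. null_rel N `` {\<lambda>k. c *\<^sub>R x k | x. x \<in> a}),
     nrm = (\<lambda>a. THE r. \<exists>x\<in>a. (\<lambda>k. N (x k)) \<longlonglongrightarrow> r)\<rparr>"

definition const_class :: "('v::real_vector \<Rightarrow> real) \<Rightarrow> 'v \<Rightarrow> (nat \<Rightarrow> 'v) set" where
  "const_class N v = null_rel N `` {\<lambda>k. v}"

section \<open>Monotone families of Banach spaces\<close>

definition monotone_family :: "ereal \<Rightarrow> (real \<Rightarrow> 'v::real_vector \<Rightarrow> real) \<Rightarrow> bool" where
  "monotone_family T N \<longleftrightarrow> (\<forall>t\<in>einterval 0 T. seminorm (N t)) \<and>
     (\<forall>v. antimono_on (einterval 0 T) (\<lambda>t. N t v))"

abbreviation Xsp :: "(real \<Rightarrow> 'v::real_vector \<Rightarrow> real) \<Rightarrow> real \<Rightarrow> (nat \<Rightarrow> 'v) set nspace" where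
  "Xsp N t \<equiv> seminorm_completion (N t)"

text \<open>
  The \<open>N s\<close>-Cauchy sequences converging to \<open>a\<close> in \<open>X\<^sub>s\<close> are the elements of \<open>a\<close>; they are
  \<open>N t\<close>-Cauchy, and the image of \<open>a\<close> is their common class in \<open>X\<^sub>t\<close>.
\<close>

definition Pop :: "(real \<Rightarrow> 'v::real_vector \<Rightarrow> real) \<Rightarrow> real \<Rightarrow> real \<Rightarrow>
    (nat \<Rightarrow> 'v) set \<Rightarrow> (nat \<Rightarrow> 'v) set" where
  "Pop N s t a = null_rel (N t) `` a"

section \<open>Scalar and vector-valued Lebesgue spaces\<close>

text \<open>
  Functions and sections are not quotiented by a.e. equality; values outside \<open>(0,T)\<close> are irrelevant.
\<close>

definition leb :: "ereal \<Rightarrow> real measure" where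
  "leb T = lebesgue_on (einterval 0 T)"

definition Lp :: "ereal \<Rightarrow> 'a measure \<Rightarrow> ('a \<Rightarrow> real) set" where
  "Lp p M = {h \<in> borel_measurable M.
     if p = \<infinity> then esssup M (\<lambda>x. ereal \<bar>h x\<bar>) < \<infinity>
     else integrable M (\<lambda>x. \<bar>h x\<bar> powr real_of_ereal p)}"

definition Lp_norm :: "ereal \<Rightarrow> 'a measure \<Rightarrow> ('a \<Rightarrow> real) \<Rightarrow> real" where
  "Lp_norm p M h =
     (if p = \<infinity> then real_of_ereal (esssup M (\<lambda>x. ereal \<bar>h x\<bar>))
      else (LINT x|M. \<bar>h x\<bar> powr real_of_ereal p) powr (1 / real_of_ereal p))"

definition is_section :: "ereal \<Rightarrow> (real \<Rightarrow> 'v::real_vector \<Rightarrow> real) \<Rightarrow>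
    (real \<Rightarrow> (nat \<Rightarrow> 'v) set) \<Rightarrow> bool" where
  "is_section T N f \<longleftrightarrow> (\<forall>t\<in>einterval 0 T. f t \<in> points (Xsp N t))"

definition simple_section :: "ereal \<Rightarrow> (real \<Rightarrow> 'v::real_vector \<Rightarrow> real) \<Rightarrow>
    (real \<Rightarrow> (nat \<Rightarrow> 'v) set) \<Rightarrow> bool" where
  "simple_section T N f \<longleftrightarrow>
     (\<exists>n (A :: nat \<Rightarrow> real set) (v :: nat \<Rightarrow> 'v).
        (\<forall>k\<in>{1..n}. A k \<in> sets (leb T)) \<and>
        (\<forall>t\<in>einterval 0 T. f t = const_class (N t) (\<Sum>k=1..n. indicator (A k) t *\<^sub>R v k)))"

definition measurable_section :: "ereal \<Rightarrow> (real \<Rightarrow> 'v::real_vector \<Rightarrow> real) \<Rightarrow>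
    (real \<Rightarrow> (nat \<Rightarrow> 'v) set) \<Rightarrow> bool" where
  "measurable_section T N f \<longleftrightarrow> is_section T N f \<and>
     (\<exists>F. (\<forall>k::nat. simple_section T N (F k)) \<and>
        (AE t in leb T. (\<lambda>k. nrm (Xsp N t) (nsub (Xsp N t) (F k t) (f t))) \<longlonglongrightarrow> 0))"

definition Lp_sections :: "ereal \<Rightarrow> ereal \<Rightarrow> (real \<Rightarrow> 'v::real_vector \<Rightarrow> real) \<Rightarrow>
    (real \<Rightarrow> (nat \<Rightarrow> 'v) set) set" where
  "Lp_sections p T N = {f. measurable_section T N f \<and> (\<lambda>t. nrm (Xsp N t) (f t)) \<in> Lp p (leb T)}"

definition Lp_section_norm :: "ereal \<Rightarrow> ereal \<Rightarrow> (real \<Rightarrow> 'v::real_vector \<Rightarrow> real) \<Rightarrow>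
    (real \<Rightarrow> (nat \<Rightarrow> 'v) set) \<Rightarrow> real" where
  "Lp_section_norm p T N f = Lp_norm p (leb T) (\<lambda>t. nrm (Xsp N t) (f t))"

section \<open>Upper gradients and the Sobolev space\<close>

text \<open>
  ``Almost all \<open>s, t\<close>'' refers to Lebesgue measure on the plane. An upper gradient is not required
  to be non-negative.
\<close>

definition upper_gradient :: "ereal \<Rightarrow> ereal \<Rightarrow> (real \<Rightarrow> 'v::real_vector \<Rightarrow> real) \<Rightarrow>
    (real \<Rightarrow> (nat \<Rightarrow> 'v) set) \<Rightarrow> (real \<Rightarrow> real) \<Rightarrow> bool" where
  "upper_gradient p T N u g \<longleftrightarrow> g \<in> Lp p (leb T) \<and>
     (AE (s, t) in lebesgue. s \<in> einterval 0 T \<longrightarrow> t \<in> einterval 0 T \<longrightarrow> s \<le> t \<longrightarrow>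
        nrm (Xsp N t) (nsub (Xsp N t) (u t) (Pop N s t (u s))) \<le> (LINT \<tau>:{s..t}|lebesgue. g \<tau>))"

definition W1p :: "ereal \<Rightarrow> ereal \<Rightarrow> (real \<Rightarrow> 'v::real_vector \<Rightarrow> real) \<Rightarrow>
    (real \<Rightarrow> (nat \<Rightarrow> 'v) set) set" where
  "W1p p T N = {u \<in> Lp_sections p T N. \<exists>g. upper_gradient p T N u g}"

end

theory Submission
  imports Defs
begin

text \<open>
  The increment \<open>d s t = \<parallel>u t - P s t (u s)\<parallel>\<^sub>t\<close> satisfies \<open>d s r \<le> d s t + d t r\<close>, so an upper gradient
  \<open>g\<close> satisfies \<open>d s t \<le> \<integral> g\<close> over \<open>[s,t]\<close> for all \<open>s \<le> t\<close> in a co-null set, not just for almost all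
  pairs. Additivity of the integral lets one switch between two upper gradients at any point, hence
  along any Borel set; so the upper gradients are closed under minima and, by dominated convergence,
  under countable infima. The infimum of a minimizing sequence of positive parts is therefore a
  minimizer \<open>h\<close>, for every \<open>p\<close> including \<open>1\<close> and \<open>\<infinity>\<close>. Only the norm of \<open>v\<close> matters, so \<open>v t\<close> can be taken
  to be \<open>h t\<close> times a measurably chosen unit vector of \<open>X\<^sub>t\<close>, and \<open>0\<close> once the seminorms vanish.
\<close>

section \<open>The completion of a seminormed space\<close>

lemma tendsto_0_squeeze:
  fixes f g :: "nat \<Rightarrow> real"
  assumes "\<And>k. 0 \<le> f k" "\<And>k. f k \<le> g k" "g \<longlonglongrightarrow> 0"
  shows "f \<longlonglongrightarrow> 0"
  by (rule tendsto_sandwich[OF _ _ tendsto_const assms(3)]) (simp_all add: assms(1,2))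

lemma seminormD:
  assumes "seminorm N"
  shows "0 \<le> N x" and "N (x + y) \<le> N x + N y" and "N (c *\<^sub>R x) = \<bar>c\<bar> * N x"
    and "N 0 = 0" and "N (x - y) = N (y - x)" and "\<bar>N x - N y\<bar> \<le> N (x - y)"
    and "N (x - z) \<le> N (x - y) + N (y - z)"
proof -
  have a: "N (x + y) \<le> N x + N y" for x y
    using assms by (auto simp: seminorm_def)
  have b: "N (c *\<^sub>R x) = \<bar>c\<bar> * N x" for c x
    using assms by (auto simp: seminorm_def)
  show "0 \<le> N x" using assms by (auto simp: seminorm_def)
  show "N (x + y) \<le> N x + N y" by (rule a)
  show "N (c *\<^sub>R x) = \<bar>c\<bar> * N x" by (rule b)
  show "N 0 = 0" using b[of 0 0] by simp
  have c: "N (x - y) = N (y - x)" for x y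
    using b[of "-1" "x - y"] by simp
  show "N (x - y) = N (y - x)" by (rule c)
  show "\<bar>N x - N y\<bar> \<le> N (x - y)"
    using a[of "x - y" y] a[of "y - x" x] c[of x y] by auto
  show "N (x - z) \<le> N (x - y) + N (y - z)"
    using a[of "x - y" "y - z"] by simp
qed

lemma Cauchy_seqs_const: "seminorm N \<Longrightarrow> (\<lambda>k. v) \<in> Cauchy_seqs N"
  by (auto simp: Cauchy_seqs_def seminormD(4))

lemma Cauchy_seqs_convergent:
  assumes "seminorm N" "x \<in> Cauchy_seqs N"
  shows "convergent (\<lambda>k. N (x k))"
proof (rule real_Cauchy_convergent, rule CauchyI)
  fix e :: real assume "0 < e"
  then obtain M where "\<forall>m\<ge>M. \<forall>n\<ge>M. N (x m - x n) < e"
    using assms(2) by (auto simp: Cauchy_seqs_def)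
  then show "\<exists>M. \<forall>m\<ge>M. \<forall>n\<ge>M. norm (N (x m) - N (x n)) < e"
    using seminormD(6)[OF assms(1)] by (metis order.strict_trans1 real_norm_def)
qed

lemma Cauchy_seqs_add:
  assumes "seminorm N" "x \<in> Cauchy_seqs N" "y \<in> Cauchy_seqs N"
  shows "(\<lambda>k. x k + y k) \<in> Cauchy_seqs N"
  unfolding Cauchy_seqs_def mem_Collect_eq
proof (intro allI impI)
  fix e :: real assume "0 < e"
  then have "0 < e/2" by simp
  then obtain M1 M2 where M: "\<forall>m\<ge>M1. \<forall>n\<ge>M1. N (x m - x n) < e/2" "\<forall>m\<ge>M2. \<forall>n\<ge>M2. N (y m - y n) < e/2"
    using assms(2,3) unfolding Cauchy_seqs_def by blast
  show "\<exists>M. \<forall>m\<ge>M. \<forall>n\<ge>M. N (x m + y m - (x n + y n)) < e"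
  proof (intro exI allI impI)
    fix m n assume "max M1 M2 \<le> m" "max M1 M2 \<le> n"
    then have "N (x m - x n) < e/2" "N (y m - y n) < e/2" using M by auto
    moreover have "N (x m + y m - (x n + y n)) \<le> N (x m - x n) + N (y m - y n)"
      using seminormD(2)[OF assms(1), of "x m - x n" "y m - y n"] by (simp add: algebra_simps)
    ultimately show "N (x m + y m - (x n + y n)) < e" by simp
  qed
qed

lemma Cauchy_seqs_scale:
  assumes "seminorm N" "x \<in> Cauchy_seqs N"
  shows "(\<lambda>k. c *\<^sub>R x k) \<in> Cauchy_seqs N"
  unfolding Cauchy_seqs_def mem_Collect_eq
proof (intro allI impI)
  fix e :: real assume "0 < e"
  then have "0 < e / (\<bar>c\<bar> + 1)" by simp
  then obtain M where M: "\<forall>m\<ge>M. \<forall>n\<ge>M. N (x m - x n) < e / (\<bar>c\<bar> + 1)"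
    using assms(2) unfolding Cauchy_seqs_def by blast
  show "\<exists>M. \<forall>m\<ge>M. \<forall>n\<ge>M. N (c *\<^sub>R x m - c *\<^sub>R x n) < e"
  proof (intro exI allI impI)
    fix m n assume "M \<le> m" "M \<le> n"
    then have "N (x m - x n) * (\<bar>c\<bar> + 1) < e"
      using M by (simp add: pos_less_divide_eq)
    moreover have "N (c *\<^sub>R x m - c *\<^sub>R x n) = \<bar>c\<bar> * N (x m - x n)"
      using seminormD(3)[OF assms(1), of c "x m - x n"] by (simp add: scaleR_diff_right)
    ultimately show "N (c *\<^sub>R x m - c *\<^sub>R x n) < e"
      using seminormD(1)[OF assms(1), of "x m - x n"] by (simp add: algebra_simps)
  qed
qed

lemma Cauchy_seqs_diff:
  assumes "seminorm N" "x \<in> Cauchy_seqs N" "y \<in> Cauchy_seqs N"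
  shows "(\<lambda>k. x k - y k) \<in> Cauchy_seqs N"
  using Cauchy_seqs_add[OF assms(1,2) Cauchy_seqs_scale[OF assms(1,3), of "-1"]] by simp

lemma equiv_null_rel:
  assumes "seminorm N"
  shows "equiv (Cauchy_seqs N) (null_rel N)"
proof (rule equivI)
  show "null_rel N \<subseteq> Cauchy_seqs N \<times> Cauchy_seqs N" by (auto simp: null_rel_def)
  show "refl_on (Cauchy_seqs N) (null_rel N)"
    by (auto simp: refl_on_def null_rel_def seminormD(4)[OF assms])
  show "sym (null_rel N)"
    by (auto simp: sym_def null_rel_def seminormD(5)[OF assms])
  show "trans (null_rel N)"
  proof (rule transI)
    fix x y z assume a: "(x, y) \<in> null_rel N" "(y, z) \<in> null_rel N"
    then have "(\<lambda>k. N (x k - y k) + N (y k - z k)) \<longlonglongrightarrow> 0 + 0"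
      by (intro tendsto_add) (auto simp: null_rel_def)
    then have "(\<lambda>k. N (x k - z k)) \<longlonglongrightarrow> 0"
      by (intro tendsto_0_squeeze[OF seminormD(1)[OF assms] seminormD(7)[OF assms]]) simp
    then show "(x, z) \<in> null_rel N" using a by (auto simp: null_rel_def)
  qed
qed

lemma null_rel_limit:
  assumes "seminorm N" "(x, y) \<in> null_rel N" "(\<lambda>k. N (x k)) \<longlonglongrightarrow> r"
  shows "(\<lambda>k. N (y k)) \<longlonglongrightarrow> r"
proof -
  have "(\<lambda>k. N (y k) - N (x k)) \<longlonglongrightarrow> 0"
  proof (rule Lim_null_comparison)
    have "norm (N (y k) - N (x k)) \<le> N (x k - y k)" for k
      using seminormD(6)[OF assms(1), of "x k" "y k"] by (simp add: abs_minus_commute)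
    then show "\<forall>\<^sub>F k in sequentially. norm (N (y k) - N (x k)) \<le> N (x k - y k)" by simp
    show "(\<lambda>k. N (x k - y k)) \<longlonglongrightarrow> 0" using assms(2) by (simp add: null_rel_def)
  qed
  from tendsto_add[OF this assms(3)] show ?thesis by simp
qed

definition cls :: "('v::real_vector \<Rightarrow> real) \<Rightarrow> (nat \<Rightarrow> 'v) \<Rightarrow> (nat \<Rightarrow> 'v) set" where
  "cls N x = null_rel N `` {x}"

lemma cls_points: "x \<in> Cauchy_seqs N \<Longrightarrow> cls N x \<in> points (seminorm_completion N)"
  by (auto simp: seminorm_completion_def cls_def intro: quotientI)

lemma points_cls:
  assumes "a \<in> points (seminorm_completion N)"
  obtains x where "x \<in> Cauchy_seqs N" "a = cls N x"
  using assms by (auto simp: seminorm_completion_def cls_def elim: quotientE)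

lemma cls_mem_iff: "y \<in> cls N x \<longleftrightarrow> (x, y) \<in> null_rel N"
  by (simp add: cls_def)

lemma cls_self: "seminorm N \<Longrightarrow> x \<in> Cauchy_seqs N \<Longrightarrow> x \<in> cls N x"
  using equiv_null_rel[of N] by (auto simp: cls_def equiv_def refl_on_def)

lemma nrm_cls:
  assumes N: "seminorm N" and x: "x \<in> Cauchy_seqs N"
  shows "(\<lambda>k. N (x k)) \<longlonglongrightarrow> nrm (seminorm_completion N) (cls N x)"
proof -
  obtain r where r: "(\<lambda>k. N (x k)) \<longlonglongrightarrow> r"
    using Cauchy_seqs_convergent[OF assms] by (auto simp: convergent_def)
  have "(THE r. \<exists>y\<in>cls N x. (\<lambda>k. N (y k)) \<longlonglongrightarrow> r) = r"
  proof (rule the_equality)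
    show "\<exists>y\<in>cls N x. (\<lambda>k. N (y k)) \<longlonglongrightarrow> r" using r cls_self[OF assms] by blast
    fix q assume "\<exists>y\<in>cls N x. (\<lambda>k. N (y k)) \<longlonglongrightarrow> q"
    then obtain y where "(x, y) \<in> null_rel N" "(\<lambda>k. N (y k)) \<longlonglongrightarrow> q"
      by (auto simp: cls_mem_iff)
    then show "q = r" using null_rel_limit[OF N _ r] LIMSEQ_unique by blast
  qed
  with r show ?thesis by (simp add: seminorm_completion_def)
qed

lemma null_rel_Image:
  assumes N: "seminorm N" and S: "x \<in> S" "\<And>y. y \<in> S \<Longrightarrow> (x, y) \<in> null_rel N"
  shows "null_rel N `` S = cls N x"
proof
  have "trans (null_rel N)" using equiv_null_rel[OF N] by (simp add: equiv_def)
  then show "null_rel N `` S \<subseteq> cls N x"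
    using S(2) by (auto simp: cls_def dest: transD)
  show "cls N x \<subseteq> null_rel N `` S" using S(1) by (auto simp: cls_def)
qed

lemma nadd_cls:
  assumes N: "seminorm N" and x: "x \<in> Cauchy_seqs N" and y: "y \<in> Cauchy_seqs N"
  shows "nadd (seminorm_completion N) (cls N x) (cls N y) = cls N (\<lambda>k. x k + y k)"
proof -
  have "null_rel N `` {\<lambda>k. x' k + y' k | x' y'. x' \<in> cls N x \<and> y' \<in> cls N y} = cls N (\<lambda>k. x k + y k)"
  proof (rule null_rel_Image[OF N])
    show "(\<lambda>k. x k + y k) \<in> {\<lambda>k. x' k + y' k | x' y'. x' \<in> cls N x \<and> y' \<in> cls N y}"
      by (rule CollectI, rule exI[of _ x], rule exI[of _ y]) (simp add: cls_self N x y)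
    fix z assume "z \<in> {\<lambda>k. x' k + y' k | x' y'. x' \<in> cls N x \<and> y' \<in> cls N y}"
    then obtain x' y' where z: "z = (\<lambda>k. x' k + y' k)" "(x, x') \<in> null_rel N" "(y, y') \<in> null_rel N"
      by (auto simp: cls_mem_iff)
    have "(\<lambda>k. N (x k - x' k) + N (y k - y' k)) \<longlonglongrightarrow> 0 + 0"
      using z by (intro tendsto_add) (auto simp: null_rel_def)
    then have "(\<lambda>k. N ((x k - x' k) + (y k - y' k))) \<longlonglongrightarrow> 0"
      by (intro tendsto_0_squeeze[OF seminormD(1)[OF N] seminormD(2)[OF N]]) simp
    then have "(\<lambda>k. N (x k + y k - z k)) \<longlonglongrightarrow> 0"
      by (simp add: z algebra_simps)
    then show "((\<lambda>k. x k + y k), z) \<in> null_rel N"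
      using z x y Cauchy_seqs_add[OF N] by (auto simp: null_rel_def)
  qed
  then show ?thesis by (simp add: seminorm_completion_def)
qed

lemma nscale_cls:
  assumes N: "seminorm N" and x: "x \<in> Cauchy_seqs N"
  shows "nscale (seminorm_completion N) c (cls N x) = cls N (\<lambda>k. c *\<^sub>R x k)"
proof -
  have "null_rel N `` {\<lambda>k. c *\<^sub>R x' k | x'. x' \<in> cls N x} = cls N (\<lambda>k. c *\<^sub>R x k)"
  proof (rule null_rel_Image[OF N])
    show "(\<lambda>k. c *\<^sub>R x k) \<in> {\<lambda>k. c *\<^sub>R x' k | x'. x' \<in> cls N x}"
      by (rule CollectI, rule exI[of _ x]) (simp add: cls_self N x)
    fix z assume "z \<in> {\<lambda>k. c *\<^sub>R x' k | x'. x' \<in> cls N x}"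
    then obtain x' where z: "z = (\<lambda>k. c *\<^sub>R x' k)" "(x, x') \<in> null_rel N"
      by (auto simp: cls_mem_iff)
    have "(\<lambda>k. \<bar>c\<bar> * N (x k - x' k)) \<longlonglongrightarrow> \<bar>c\<bar> * 0"
      using z by (intro tendsto_mult_left) (auto simp: null_rel_def)
    then have "(\<lambda>k. N (c *\<^sub>R x k - z k)) \<longlonglongrightarrow> 0"
      by (simp add: z flip: scaleR_diff_right seminormD(3)[OF N])
    then show "((\<lambda>k. c *\<^sub>R x k), z) \<in> null_rel N"
      using z x Cauchy_seqs_scale[OF N] by (auto simp: null_rel_def)
  qed
  then show ?thesis by (simp add: seminorm_completion_def)
qed

lemma nsub_cls:
  assumes N: "seminorm N" and x: "x \<in> Cauchy_seqs N" and y: "y \<in> Cauchy_seqs N"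
  shows "nsub (seminorm_completion N) (cls N x) (cls N y) = cls N (\<lambda>k. x k - y k)"
  unfolding nsub_def nscale_cls[OF N y] nadd_cls[OF N x Cauchy_seqs_scale[OF N y]] by simp

lemma const_class_eq_cls: "const_class N v = cls N (\<lambda>k. v)"
  by (simp add: const_class_def cls_def)

lemma nrm_const_class: "seminorm N \<Longrightarrow> nrm (seminorm_completion N) (const_class N v) = N v"
  using LIMSEQ_unique[OF nrm_cls[OF _ Cauchy_seqs_const] tendsto_const, of N]
  by (metis const_class_eq_cls)

lemma nsub_const_class:
  "seminorm N \<Longrightarrow> nsub (seminorm_completion N) (const_class N v) (const_class N w) = const_class N (v - w)"
  by (simp add: const_class_eq_cls nsub_cls Cauchy_seqs_const)

lemma Cauchy_seqs_mono:
  assumes "\<And>v. N' v \<le> N v" "x \<in> Cauchy_seqs N"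
  shows "x \<in> Cauchy_seqs N'"
  unfolding Cauchy_seqs_def mem_Collect_eq
proof (intro allI impI)
  fix e :: real assume "0 < e"
  then obtain M where "\<forall>m\<ge>M. \<forall>n\<ge>M. N (x m - x n) < e"
    using assms(2) unfolding Cauchy_seqs_def by blast
  then show "\<exists>M. \<forall>m\<ge>M. \<forall>n\<ge>M. N' (x m - x n) < e"
    by (intro exI[of _ M] allI impI le_less_trans[OF assms(1)]) simp
qed

lemma Pop_cls:
  assumes N: "seminorm (N s)" "seminorm (N t)" and le: "\<And>v. N t v \<le> N s v"
    and x: "x \<in> Cauchy_seqs (N s)"
  shows "Pop N s t (cls (N s) x) = cls (N t) x"
  unfolding Pop_def
proof (rule null_rel_Image[OF N(2)])
  show "x \<in> cls (N s) x" by (rule cls_self[OF N(1) x])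
  fix y assume "y \<in> cls (N s) x"
  then have y: "y \<in> Cauchy_seqs (N s)" "(\<lambda>k. N s (x k - y k)) \<longlonglongrightarrow> 0"
    by (auto simp: cls_mem_iff null_rel_def)
  have "(\<lambda>k. N t (x k - y k)) \<longlonglongrightarrow> 0"
    by (rule tendsto_0_squeeze[OF seminormD(1)[OF N(2)] le y(2)])
  then show "(x, y) \<in> null_rel (N t)"
    using x y(1) Cauchy_seqs_mono[OF le] by (auto simp: null_rel_def)
qed

section \<open>Increments of a section\<close>

definition incr :: "(real \<Rightarrow> 'v::real_vector \<Rightarrow> real) \<Rightarrow> (real \<Rightarrow> (nat \<Rightarrow> 'v) set) \<Rightarrow> real \<Rightarrow> real \<Rightarrow> real"
  where "incr N u s t = nrm (Xsp N t) (nsub (Xsp N t) (u t) (Pop N s t (u s)))"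

lemma monotone_familyD:
  assumes "monotone_family T N"
  shows "t \<in> einterval 0 T \<Longrightarrow> seminorm (N t)"
    and "s \<in> einterval 0 T \<Longrightarrow> t \<in> einterval 0 T \<Longrightarrow> s \<le> t \<Longrightarrow> N t v \<le> N s v"
  using assms unfolding monotone_family_def monotone_on_def by blast+

lemma incr_limit:
  assumes mf: "monotone_family T N"
    and st: "s \<in> einterval 0 T" "t \<in> einterval 0 T" "s \<le> t"
    and x: "x \<in> Cauchy_seqs (N s)" "u s = cls (N s) x"
    and y: "y \<in> Cauchy_seqs (N t)" "u t = cls (N t) y"
  shows "(\<lambda>k. N t (y k - x k)) \<longlonglongrightarrow> incr N u s t"
proof -
  note N = monotone_familyD(1)[OF mf st(1)] monotone_familyD(1)[OF mf st(2)]
  note le = monotone_familyD(2)[OF mf st]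
  have xt: "x \<in> Cauchy_seqs (N t)" by (rule Cauchy_seqs_mono[OF le x(1)])
  show ?thesis
    unfolding incr_def x y Pop_cls[OF N le x(1)] nsub_cls[OF N(2) y(1) xt]
    by (rule nrm_cls[OF N(2) Cauchy_seqs_diff[OF N(2) y(1) xt]])
qed

lemma incr_triangle:
  assumes mf: "monotone_family T N" and u: "is_section T N u"
    and "s \<in> einterval 0 T" "t \<in> einterval 0 T" "r \<in> einterval 0 T" "s \<le> t" "t \<le> r"
  shows "incr N u s r \<le> incr N u s t + incr N u t r"
proof -
  obtain x y z where x: "x \<in> Cauchy_seqs (N s)" "u s = cls (N s) x"
    and y: "y \<in> Cauchy_seqs (N t)" "u t = cls (N t) y"
    and z: "z \<in> Cauchy_seqs (N r)" "u r = cls (N r) z"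
    using u assms(3-5) by (metis is_section_def points_cls)
  have "N r (z k - x k) \<le> N t (y k - x k) + N r (z k - y k)" for k
    using monotone_familyD(2)[OF mf \<open>t \<in> _\<close> \<open>r \<in> _\<close> \<open>t \<le> r\<close>, of "y k - x k"]
      seminormD(7)[OF monotone_familyD(1)[OF mf \<open>r \<in> _\<close>], of "z k" "x k" "y k"] by simp
  moreover have "(\<lambda>k. N t (y k - x k) + N r (z k - y k)) \<longlonglongrightarrow> incr N u s t + incr N u t r"
    using assms x y z by (intro tendsto_add incr_limit[OF mf]) auto
  moreover have "(\<lambda>k. N r (z k - x k)) \<longlonglongrightarrow> incr N u s r"
    using assms x z by (intro incr_limit[OF mf]) auto
  ultimately show ?thesis by (intro LIMSEQ_le) auto
qed

lemma incr_eq_0: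
  assumes mf: "monotone_family T N" and u: "is_section T N u"
    and st: "s \<in> einterval 0 T" "t \<in> einterval 0 T" "s \<le> t"
    and "s = t \<or> (\<forall>v. N t v = 0)"
  shows "incr N u s t = 0"
proof -
  obtain x y where x: "x \<in> Cauchy_seqs (N s)" "u s = cls (N s) x"
    and y: "y \<in> Cauchy_seqs (N t)" "u t = cls (N t) y" and "s = t \<Longrightarrow> y = x"
    using u st by (metis is_section_def points_cls)
  then have "N t (y k - x k) = 0" for k
    using assms(6) seminormD(4)[OF monotone_familyD(1)[OF mf st(2)]] by auto
  with incr_limit[OF mf st x y] show ?thesis by (simp add: LIMSEQ_const_iff)
qed

section \<open>Integral majorants of subadditive interval functions\<close>

lemma set_integrable_If:
  fixes f g :: "'a \<Rightarrow> real"
  assumes "A \<in> sets M" "set_integrable M S f" "set_integrable M S g"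
  shows "set_integrable M S (\<lambda>x. if x \<in> A then f x else g x)"
proof -
  have "integrable M (\<lambda>x. indicator S x *\<^sub>R g x +
      (indicator A x *\<^sub>R (indicator S x *\<^sub>R f x) - indicator A x *\<^sub>R (indicator S x *\<^sub>R g x)))"
    using assms unfolding set_integrable_def
    by (intro Bochner_Integration.integrable_add Bochner_Integration.integrable_diff
        integrable_mult_indicator[OF assms(1)])
  also have "(\<lambda>x. indicator S x *\<^sub>R g x +
      (indicator A x *\<^sub>R (indicator S x *\<^sub>R f x) - indicator A x *\<^sub>R (indicator S x *\<^sub>R g x)))
    = (\<lambda>x. indicator S x *\<^sub>R (if x \<in> A then f x else g x))"
    by (auto simp: indicator_def)
  finally show ?thesis unfolding set_integrable_def .
qed

lemma set_integral_dominated: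
  fixes h :: "nat \<Rightarrow> 'a \<Rightarrow> real"
  assumes h: "\<And>n. set_integrable M S (h n)" and w: "set_integrable M S w"
    and le: "\<And>n x. x \<in> S \<Longrightarrow> \<bar>h n x\<bar> \<le> w x"
    and lim: "\<And>x. x \<in> S \<Longrightarrow> (\<lambda>n. h n x) \<longlonglongrightarrow> g x"
  shows "set_integrable M S g"
    and "(\<lambda>n. LINT x:S|M. h n x) \<longlonglongrightarrow> (LINT x:S|M. g x)"
proof -
  have lim': "(\<lambda>n. indicator S x *\<^sub>R h n x) \<longlonglongrightarrow> indicator S x *\<^sub>R g x" for x
    using lim by (auto simp: indicator_def)
  have meas: "(\<lambda>x. indicator S x *\<^sub>R h n x) \<in> borel_measurable M" for n
    using h[of n] unfolding set_integrable_def by (rule borel_measurable_integrable)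
  have meas': "(\<lambda>x. indicator S x *\<^sub>R g x) \<in> borel_measurable M"
    by (rule borel_measurable_LIMSEQ_real[OF lim' meas])
  have w': "integrable M (\<lambda>x. indicator S x *\<^sub>R w x)"
    using w unfolding set_integrable_def .
  have le': "norm (indicator S x *\<^sub>R h n x) \<le> indicator S x *\<^sub>R w x" for n x
    using le by (auto simp: indicator_def)
  show "set_integrable M S g" unfolding set_integrable_def
    by (rule integrable_dominated_convergence[where s="\<lambda>n x. indicator S x *\<^sub>R h n x",
        OF meas' meas w'])
      (intro AE_I2 lim', intro AE_I2 le')
  show "(\<lambda>n. LINT x:S|M. h n x) \<longlonglongrightarrow> (LINT x:S|M. g x)"
    unfolding set_lebesgue_integral_def
    by (rule integral_dominated_convergence[where s="\<lambda>n x. indicator S x *\<^sub>R h n x",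
        OF meas' meas w'])
      (intro AE_I2 lim', intro AE_I2 le')
qed

lemma set_integral_split:
  fixes f g :: "real \<Rightarrow> real"
  assumes "s \<le> c" "c \<le> t"
    and f: "set_integrable lebesgue {s..c} f" and g: "set_integrable lebesgue {c..t} g"
  shows "(LINT x:{s..t}|lebesgue. if x \<le> c then f x else g x) =
    (LINT x:{s..c}|lebesgue. f x) + (LINT x:{c..t}|lebesgue. g x)"
proof -
  let ?h = "\<lambda>x. if x \<le> c then f x else g x"
  have g': "set_integrable lebesgue {c<..t} g"
    by (rule set_integrable_subset[OF g]) auto
  have "(LINT x:{s..t}|lebesgue. ?h x) = (LINT x:{s..c} \<union> {c<..t}|lebesgue. ?h x)"
    using assms(1,2) by (simp add: ivl_disj_un)
  also have "\<dots> = (LINT x:{s..c}|lebesgue. ?h x) + (LINT x:{c<..t}|lebesgue. ?h x)"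
  proof (rule set_integral_Un)
    show "set_integrable lebesgue {s..c} ?h"
      using f by (subst set_integrable_cong[OF refl refl]) auto
    show "set_integrable lebesgue {c<..t} ?h"
      using g' by (subst set_integrable_cong[OF refl refl]) auto
  qed auto
  also have "(LINT x:{s..c}|lebesgue. ?h x) = (LINT x:{s..c}|lebesgue. f x)"
    by (rule set_lebesgue_integral_cong) auto
  also have "(LINT x:{c<..t}|lebesgue. ?h x) = (LINT x:{c<..t}|lebesgue. g x)"
    by (rule set_lebesgue_integral_cong) auto
  also have "\<dots> = (LINT x:{c..t}|lebesgue. g x)"
  proof (rule set_integral_cong_set)
    show "set_borel_measurable lebesgue {c..t} g" "set_borel_measurable lebesgue {c<..t} g"
      using g g' unfolding set_borel_measurable_def set_integrable_def
      by (auto dest: borel_measurable_integrable)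
    have "AE x in lebesgue. x \<noteq> c"
      by (intro AE_completion AE_lborel_singleton)
    then show "AE x in lebesgue. (x \<in> {c..t}) = (x \<in> {c<..t})"
      by eventually_elim auto
  qed
  finally show ?thesis .
qed

definition majorant :: "real set \<Rightarrow> (real \<Rightarrow> real \<Rightarrow> real) \<Rightarrow> (real \<Rightarrow> real) \<Rightarrow> bool" where
  "majorant E d g \<longleftrightarrow> (\<forall>s\<in>E. \<forall>t\<in>E. s \<le> t \<longrightarrow>
     set_integrable lebesgue {s..t} g \<and> d s t \<le> (LINT x:{s..t}|lebesgue. g x))"

lemma majorantD:
  assumes "majorant E d g" "s \<in> E" "t \<in> E" "s \<le> t"
  shows "set_integrable lebesgue {s..t} g" "d s t \<le> (LINT x:{s..t}|lebesgue. g x)"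
  using assms by (auto simp: majorant_def)

lemma majorant_limit:
  assumes h: "\<And>n::nat. majorant E d (h n)"
    and w: "\<And>s t. s \<in> E \<Longrightarrow> t \<in> E \<Longrightarrow> s \<le> t \<Longrightarrow> set_integrable lebesgue {s..t} w"
    and le: "\<And>n x. \<bar>h n x\<bar> \<le> w x" and lim: "\<And>x. (\<lambda>n. h n x) \<longlonglongrightarrow> g x"
  shows "majorant E d g"
  unfolding majorant_def
proof (intro ballI impI conjI)
  fix s t assume st: "s \<in> E" "t \<in> E" "s \<le> t"
  note D = set_integral_dominated[OF majorantD(1)[OF h st] w[OF st] le lim]
  show "set_integrable lebesgue {s..t} g" by (rule D(1))
  show "d s t \<le> (LINT x:{s..t}|lebesgue. g x)"
    by (rule LIMSEQ_le_const[OF D(2)]) (auto intro: majorantD(2)[OF h st])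
qed

lemma majorant_abs_add_integrable:
  assumes "majorant E d f" "majorant E d g" "s \<in> E" "t \<in> E" "s \<le> t"
  shows "set_integrable lebesgue {s..t} (\<lambda>x. \<bar>f x\<bar> + \<bar>g x\<bar>)"
  using assms by (intro set_integral_add set_integrable_abs majorantD(1))

locale dense_subadditive =
  fixes E :: "real set" and d :: "real \<Rightarrow> real \<Rightarrow> real"
  assumes triangle: "s \<in> E \<Longrightarrow> t \<in> E \<Longrightarrow> r \<in> E \<Longrightarrow> s \<le> t \<Longrightarrow> t \<le> r \<Longrightarrow> d s r \<le> d s t + d t r"
    and dense: "s \<in> E \<Longrightarrow> t \<in> E \<Longrightarrow> s \<le> a \<Longrightarrow> a < b \<Longrightarrow> b \<le> t \<Longrightarrow> \<exists>r\<in>E. a < r \<and> r < b"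
begin

lemma majorant_switch:
  assumes f: "majorant E d f" and g: "majorant E d g"
  shows "majorant E d (\<lambda>x. if x \<le> c then f x else g x)"
  unfolding majorant_def
proof (intro ballI impI conjI)
  fix s t assume st: "s \<in> E" "t \<in> E" "s \<le> t"
  let ?h = "\<lambda>c x. if x \<le> c then f x else g x"
  have int: "set_integrable lebesgue {s..t} (?h c)" for c
    using set_integrable_If[OF _ majorantD(1)[OF f st] majorantD(1)[OF g st], of "{..c}"] by simp
  show "set_integrable lebesgue {s..t} (?h c)" by (rule int)
  consider "c < s" | "t \<le> c" | "s \<le> c" "c < t" by linarith
  then show "d s t \<le> (LINT x:{s..t}|lebesgue. ?h c x)"
  proof cases
    case 1
    then have "(LINT x:{s..t}|lebesgue. ?h c x) = (LINT x:{s..t}|lebesgue. g x)"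
      by (intro set_lebesgue_integral_cong) auto
    then show ?thesis using majorantD(2)[OF g st] by simp
  next
    case 2
    then have "(LINT x:{s..t}|lebesgue. ?h c x) = (LINT x:{s..t}|lebesgue. f x)"
      by (intro set_lebesgue_integral_cong) auto
    then show ?thesis using majorantD(2)[OF f st] by simp
  next
    case 3
    have "\<exists>r\<in>E. c < r \<and> r < min t (c + 1 / Suc n)" for n
      using 3 by (intro dense[OF st(1,2)]) auto
    then obtain r where r: "\<And>n. r n \<in> E" "\<And>n. c < r n" "\<And>n. r n < min t (c + 1 / Suc n)"
      by metis
    have rc: "r \<longlonglongrightarrow> c"
    proof (rule tendsto_sandwich)
      show "\<forall>\<^sub>F n in sequentially. c \<le> r n" "\<forall>\<^sub>F n in sequentially. r n \<le> c + 1 / Suc n"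
        using r by (auto intro!: always_eventually less_imp_le)
      show "(\<lambda>n. c + 1 / Suc n) \<longlonglongrightarrow> c"
        using tendsto_add[OF tendsto_const LIMSEQ_inverse_real_of_nat, of c] by (simp add: inverse_eq_divide)
    qed simp
    have "d s t \<le> (LINT x:{s..t}|lebesgue. ?h (r n) x)" for n
    proof -
      have sr: "s \<le> r n" "r n \<le> t" using r(2,3)[of n] 3 by auto
      have "d s t \<le> d s (r n) + d (r n) t" using triangle[OF st(1) r(1) st(2) sr] .
      also have "\<dots> \<le> (LINT x:{s..r n}|lebesgue. f x) + (LINT x:{r n..t}|lebesgue. g x)"
        using majorantD(2)[OF f st(1) r(1) sr(1)] majorantD(2)[OF g r(1) st(2) sr(2)] by simp
      also have "\<dots> = (LINT x:{s..t}|lebesgue. ?h (r n) x)"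
        using set_integral_split[OF sr majorantD(1)[OF f st(1) r(1) sr(1)] majorantD(1)[OF g r(1) st(2) sr(2)]]
        by simp
      finally show ?thesis .
    qed
    moreover have "(\<lambda>n. LINT x:{s..t}|lebesgue. ?h (r n) x) \<longlonglongrightarrow> (LINT x:{s..t}|lebesgue. ?h c x)"
    proof (rule set_integral_dominated(2)[OF int majorant_abs_add_integrable[OF f g st]])
      fix x
      show "(\<lambda>n. ?h (r n) x) \<longlonglongrightarrow> ?h c x"
      proof (cases "x \<le> c")
        case True
        then show ?thesis using r(2) by (simp add: order_trans[OF _ less_imp_le])
      next
        case False
        then have "\<forall>\<^sub>F n in sequentially. r n < x" using order_tendstoD(2)[OF rc] by simp
        then have "\<forall>\<^sub>F n in sequentially. ?h (r n) x = ?h c x"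
          by eventually_elim (use False in auto)
        then show ?thesis by (rule tendsto_eventually)
      qed
    qed auto
    ultimately show ?thesis by (intro LIMSEQ_le_const) auto
  qed
qed

lemma majorant_If:
  assumes A: "A \<in> sets borel" and "majorant E d f" "majorant E d g"
  shows "majorant E d (\<lambda>x. if x \<in> A then f x else g x)"
proof -
  have "A \<in> sigma_sets UNIV (range atMost)"
    using A by (metis borel_eq_atMost sets_measure_of top_greatest Pow_UNIV)
  then show ?thesis using assms(2,3)
  proof (induction A arbitrary: f g rule: sigma_sets.induct)
    case (Basic A)
    then obtain c where "A = {..c}" by auto
    then show ?case using majorant_switch[OF Basic.prems] by simp
  next
    case Empty
    then show ?case by simp
  next
    case (Compl A)
    have "(\<lambda>x. if x \<in> UNIV - A then f x else g x) = (\<lambda>x. if x \<in> A then g x else f x)"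
      by auto
    then show ?case using Compl.IH[OF Compl.prems(2,1)] by simp
  next
    case (Union A)
    have fin: "majorant E d (\<lambda>x. if x \<in> (\<Union>i<n. A i) then f x else g x)" for n
    proof (induction n)
      case 0
      then show ?case using Union.prems by simp
    next
      case (Suc n)
      have "(\<lambda>x. if x \<in> (\<Union>i<Suc n. A i) then f x else g x) =
          (\<lambda>x. if x \<in> A n then f x else if x \<in> (\<Union>i<n. A i) then f x else g x)"
        by (auto simp: lessThan_Suc fun_eq_iff)
      then show ?case using Union.IH[OF Union.prems(1) Suc.IH] by simp
    qed
    show ?case
    proof (rule majorant_limit[OF fin majorant_abs_add_integrable[OF Union.prems]])
      fix x
      show "(\<lambda>n. if x \<in> (\<Union>i<n. A i) then f x else g x) \<longlonglongrightarrow> (if x \<in> (\<Union>i. A i) then f x else g x)"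
      proof (cases "x \<in> (\<Union>i. A i)")
        case True
        then obtain i where "x \<in> A i" by auto
        then have "\<forall>\<^sub>F n in sequentially. x \<in> (\<Union>i<n. A i)"
          by (intro eventually_sequentiallyI[of "Suc i"]) auto
        then have "\<forall>\<^sub>F n in sequentially.
            (if x \<in> (\<Union>i<n. A i) then f x else g x) = (if x \<in> (\<Union>i. A i) then f x else g x)"
          by eventually_elim (use True in auto)
        then show ?thesis by (rule tendsto_eventually)
      qed simp
    qed auto
  qed
qed

lemma majorant_min:
  assumes f: "majorant E d f" "f \<in> borel_measurable lebesgue"
    and g: "majorant E d g" "g \<in> borel_measurable lebesgue"
  shows "majorant E d (\<lambda>x. min (f x) (g x))"
proof -
  obtain f' g' where f': "f' \<in> borel_measurable lborel" "AE x in lebesgue. f x = f' x"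
    and g': "g' \<in> borel_measurable lborel" "AE x in lebesgue. g x = g' x"
    using completion_ex_borel_measurable_real[OF f(2)] completion_ex_borel_measurable_real[OF g(2)]
      AE_completion by metis
  define A where "A = {x. f' x \<le> g' x}"
  have A: "A \<in> sets borel"
    using f'(1) g'(1) unfolding A_def by measurable
  then have A': "A \<in> sets lebesgue" by simp
  let ?h = "\<lambda>x. if x \<in> A then f x else g x"
  have h: "?h \<in> borel_measurable lebesgue"
    using A' f(2) g(2) by (intro measurable_If_set) auto
  have m: "(\<lambda>x. min (f x) (g x)) \<in> borel_measurable lebesgue"
    using f(2) g(2) by measurable
  have ae: "AE x in lebesgue. ?h x = min (f x) (g x)"
    using f'(2) g'(2) by eventually_elim (auto simp: A_def)
  note maj = majorant_If[OF A f(1) g(1)]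
  show ?thesis
    unfolding majorant_def
  proof (intro ballI impI conjI)
    fix s t assume st: "s \<in> E" "t \<in> E" "s \<le> t"
    have S: "{s..t} \<in> sets lebesgue" by simp
    have ae': "AE x\<in>{s..t} in lebesgue. ?h x = min (f x) (g x)"
      using ae by eventually_elim blast
    show "set_integrable lebesgue {s..t} (\<lambda>x. min (f x) (g x))"
      using majorantD(1)[OF maj st] set_integrable_cong_AE[OF h m ae' S] by simp
    have "(LINT x:{s..t}|lebesgue. ?h x) = (LINT x:{s..t}|lebesgue. min (f x) (g x))"
      by (rule set_lebesgue_integral_cong_AE[OF S h m ae'])
    then show "d s t \<le> (LINT x:{s..t}|lebesgue. min (f x) (g x))"
      using majorantD(2)[OF maj st] by simp
  qed
qed

lemma majorant_INF:
  fixes g :: "nat \<Rightarrow> real \<Rightarrow> real"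
  assumes maj: "\<And>n. majorant E d (g n)" and meas: "\<And>n. g n \<in> borel_measurable lebesgue"
    and nonneg: "\<And>n x. 0 \<le> g n x"
  obtains h where "majorant E d h" "h \<in> borel_measurable lebesgue"
    "\<And>n x. h x \<le> g n x" "\<And>x. 0 \<le> h x"
proof -
  define m where "m = rec_nat (g 0) (\<lambda>n f x. min (f x) (g (Suc n) x))"
  have m0: "m 0 = g 0" and mS: "m (Suc n) = (\<lambda>x. min (m n x) (g (Suc n) x))" for n
    by (simp_all add: m_def)
  have "majorant E d (m n) \<and> m n \<in> borel_measurable lebesgue" for n
  proof (induction n)
    case (Suc n)
    then have "m (Suc n) \<in> borel_measurable lebesgue"
      unfolding mS using meas[of "Suc n"] by (intro borel_measurable_min) auto
    then show ?case using Suc majorant_min[of "m n" "g (Suc n)"] maj meas by (simp add: mS)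
  qed (simp add: m0 maj meas)
  then have m_maj: "majorant E d (m n)" and m_meas: "m n \<in> borel_measurable lebesgue" for n
    by auto
  have m_nonneg: "0 \<le> m n x" for n x
    by (induction n) (simp_all add: m0 mS nonneg)
  have m_le: "m n x \<le> g n x" for n x
    by (cases n) (simp_all add: m0 mS)
  have dec: "decseq (\<lambda>n. m n x)" for x
    by (rule decseq_SucI) (simp add: mS)
  have bdd: "bdd_below (range (\<lambda>n. m n x))" for x
    by (rule bdd_belowI[of _ 0]) (auto simp: m_nonneg)
  define h where "h x = (INF n. m n x)" for x
  have lim: "(\<lambda>n. m n x) \<longlonglongrightarrow> h x" for x
    unfolding h_def by (rule LIMSEQ_decseq_INF[OF bdd dec])
  have le: "\<bar>m n x\<bar> \<le> g 0 x" for n x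
    using m_nonneg[of n x] decseqD[OF dec, of 0 n x] by (simp add: m0)
  show ?thesis
  proof
    show "majorant E d h"
      by (rule majorant_limit[OF m_maj majorantD(1)[OF maj] le lim])
    show "h \<in> borel_measurable lebesgue"
      by (rule borel_measurable_LIMSEQ_real[OF lim m_meas])
    show "h x \<le> g n x" for n x
      unfolding h_def by (rule cINF_lower2[OF bdd UNIV_I m_le])
    show "0 \<le> h x" for x
      unfolding h_def by (rule cINF_greatest) (auto simp: m_nonneg)
  qed
qed

end

section \<open>Upper gradients as majorants\<close>

lemma Lp_norm_nonneg:
  assumes "emeasure M (space M) \<noteq> 0" "h \<in> borel_measurable M"
  shows "0 \<le> Lp_norm p M h"
proof (cases "p = \<infinity>")
  case True
  have "0 = esssup M (\<lambda>x. 0 :: ereal)" by (rule esssup_const[OF assms(1), symmetric])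
  also have "\<dots> \<le> esssup M (\<lambda>x. ereal \<bar>h x\<bar>)" by (rule esssup_mono) auto
  finally show ?thesis using True by (simp add: Lp_norm_def real_of_ereal_pos)
qed (simp add: Lp_norm_def)

lemma Lp_mono:
  assumes p: "1 \<le> p" and M: "emeasure M (space M) \<noteq> 0"
    and f: "f \<in> borel_measurable M" and h: "h \<in> Lp p M"
    and le: "\<And>x. x \<in> space M \<Longrightarrow> \<bar>f x\<bar> \<le> \<bar>h x\<bar>"
  shows "f \<in> Lp p M" and "Lp_norm p M f \<le> Lp_norm p M h"
proof -
  have hm: "h \<in> borel_measurable M" using h by (simp add: Lp_def)
  have "f \<in> Lp p M \<and> Lp_norm p M f \<le> Lp_norm p M h"
  proof (cases "p = \<infinity>")
    case True
    have "esssup M (\<lambda>x. ereal \<bar>f x\<bar>) \<le> esssup M (\<lambda>x. ereal \<bar>h x\<bar>)"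
      using f le by (intro esssup_AE_mono AE_I2) auto
    moreover have "0 \<le> esssup M (\<lambda>x. ereal \<bar>f x\<bar>)"
      using esssup_mono[of "\<lambda>x. 0" M "\<lambda>x. ereal \<bar>f x\<bar>"] esssup_const[OF M, of "0 :: ereal"] by simp
    moreover have "esssup M (\<lambda>x. ereal \<bar>h x\<bar>) < \<infinity>"
      using h True by (simp add: Lp_def)
    ultimately show ?thesis
      using True f by (auto simp: Lp_def Lp_norm_def intro!: real_of_ereal_positive_mono)
  next
    case False
    define r where "r = real_of_ereal p"
    have r: "1 \<le> r" using p False by (cases p) (auto simp: r_def)
    have int: "integrable M (\<lambda>x. \<bar>h x\<bar> powr r)" using h False by (simp add: Lp_def r_def)
    have le': "\<bar>f x\<bar> powr r \<le> \<bar>h x\<bar> powr r" if "x \<in> space M" for x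
      using le[OF that] r by (intro powr_mono2) auto
    have int': "integrable M (\<lambda>x. \<bar>f x\<bar> powr r)"
      using f le' by (intro Bochner_Integration.integrable_bound[OF int] AE_I2) auto
    have "(LINT x|M. \<bar>f x\<bar> powr r) \<le> (LINT x|M. \<bar>h x\<bar> powr r)"
      using int' int le' by (rule integral_mono)
    then have "(LINT x|M. \<bar>f x\<bar> powr r) powr (1 / r) \<le> (LINT x|M. \<bar>h x\<bar> powr r) powr (1 / r)"
      using r by (intro powr_mono2 integral_nonneg_AE) auto
    then show ?thesis using False f int' by (simp add: Lp_def Lp_norm_def r_def)
  qed
  then show "f \<in> Lp p M" "Lp_norm p M f \<le> Lp_norm p M h" by auto
qed

lemma space_leb: "space (leb T) = einterval 0 T"
  by (simp add: leb_def)

lemma emeasure_leb_neq_0: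
  assumes "0 < T"
  shows "emeasure (leb T) (space (leb T)) \<noteq> 0"
proof -
  obtain c where "c \<in> einterval 0 T" using einterval_nonempty[OF assms] ..
  then have "0 < c" "{c/2..c} \<subseteq> einterval 0 T"
    by (cases T; auto simp: einterval_iff)+
  then have "ennreal (c/2) \<le> emeasure lborel (einterval 0 T)"
    using emeasure_mono[of "{c/2..c}" "einterval 0 T" lborel] by simp
  then have "emeasure lborel (einterval 0 T) \<noteq> 0"
    using \<open>0 < c\<close> by (auto simp: ennreal_eq_0_iff)
  then show ?thesis by (simp add: leb_def emeasure_restrict_space space_restrict_space)
qed

lemma Icc_subset_einterval: "s \<in> einterval a b \<Longrightarrow> t \<in> einterval a b \<Longrightarrow> {s..t} \<subseteq> einterval a b"
  by (cases a; cases b; auto simp: einterval_iff)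

lemma Lp_set_integrable:
  assumes p: "1 \<le> p" and g: "g \<in> Lp p (leb T)"
    and st: "s \<in> einterval 0 T" "t \<in> einterval 0 T"
  shows "set_integrable lebesgue {s..t} g"
proof -
  have gm: "g \<in> borel_measurable (leb T)" using g by (simp add: Lp_def)
  note sub = Icc_subset_einterval[OF st]
  have S: "{s..t} \<in> sets (leb T)"
    using sub by (auto simp: leb_def sets_restrict_space_iff)
  have c: "set_integrable (leb T) {s..t} (\<lambda>x. c)" for c :: real
    using sub S by (auto simp: set_integrable_def leb_def emeasure_restrict_space
        emeasure_lborel_Icc_eq intro!: integrable_mult_left integrable_real_indicator)
  obtain w where w: "set_integrable (leb T) {s..t} w" "AE x in leb T. \<bar>g x\<bar> \<le> w x"
  proof (cases "p = \<infinity>")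
    case True
    obtain C where C: "esssup (leb T) (\<lambda>x. ereal \<bar>g x\<bar>) \<le> ereal C"
      using g True by (cases "esssup (leb T) (\<lambda>x. ereal \<bar>g x\<bar>)") (auto simp: Lp_def)
    have "AE x in leb T. \<bar>g x\<bar> \<le> C"
      using esssup_AE[of "\<lambda>x. ereal \<bar>g x\<bar>" "leb T"]
    proof eventually_elim
      case (elim x)
      then show ?case using order_trans[OF elim C] by simp
    qed
    then show ?thesis using that[OF c] by blast
  next
    case False
    define r where "r = real_of_ereal p"
    have r: "1 \<le> r" using p False by (cases p) (auto simp: r_def)
    have "integrable (leb T) (\<lambda>x. \<bar>g x\<bar> powr r)" using g False by (simp add: Lp_def r_def)
    then have "set_integrable (leb T) {s..t} (\<lambda>x. \<bar>g x\<bar> powr r)"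
      unfolding set_integrable_def by (rule integrable_mult_indicator[OF S])
    then have "set_integrable (leb T) {s..t} (\<lambda>x. 1 + \<bar>g x\<bar> powr r)"
      by (intro set_integral_add c)
    moreover have "\<bar>g x\<bar> \<le> 1 + \<bar>g x\<bar> powr r" for x
    proof (cases "\<bar>g x\<bar> \<le> 1")
      case False
      then have "\<bar>g x\<bar> powr 1 \<le> \<bar>g x\<bar> powr r" using r by (intro powr_mono) auto
      then show ?thesis using False by simp
    qed (simp add: add_increasing2)
    ultimately show ?thesis by (intro that) auto
  qed
  have "set_integrable (leb T) {s..t} g"
  proof (rule set_integrable_bound[OF w(1)])
    show "set_borel_measurable (leb T) {s..t} g"
      using gm S by (auto simp: set_borel_measurable_def)
    show "AE x in leb T. x \<in> {s..t} \<longrightarrow> norm (g x) \<le> norm (w x)"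
      using w(2) by eventually_elim auto
  qed
  then have "integrable lebesgue (\<lambda>x. indicator (einterval 0 T) x *\<^sub>R (indicator {s..t} x *\<^sub>R g x))"
    unfolding set_integrable_def leb_def by (subst (asm) integrable_restrict_space) auto
  moreover have "(\<lambda>x. indicator (einterval 0 T) x *\<^sub>R (indicator {s..t} x *\<^sub>R g x)) =
      (\<lambda>x. indicator {s..t} x *\<^sub>R g x)"
    by (rule ext) (use sub in \<open>auto split: split_indicator\<close>)
  ultimately show ?thesis by (simp add: set_integrable_def)
qed

lemma AE_lborel_ex_between:
  fixes a b :: real
  assumes "AE x in lborel. P x" "a < b"
  shows "\<exists>x. a < x \<and> x < b \<and> P x"
proof (rule ccontr)
  assume "\<not> ?thesis"
  then have "AE x in lborel. x \<notin> {a<..<b}"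
    using assms(1) by (auto elim!: eventually_mono)
  then have "emeasure lborel {a<..<b} = 0"
    by (subst (asm) AE_iff_measurable[of "{a<..<b}"]) auto
  then show False using assms(2) by simp
qed

lemma set_integral_singleton: "(LINT x:{c..c::real}|lebesgue. g x) = (0 :: real)"
  unfolding set_lebesgue_integral_def
proof (rule integral_eq_zero_AE)
  have "AE x in lebesgue. x \<noteq> c"
    by (intro AE_completion AE_lborel_singleton)
  then show "AE x in lebesgue. indicator {c..c} x *\<^sub>R g x = 0"
    by eventually_elim auto
qed

lemma upper_gradient_majorant:
  assumes mf: "monotone_family T N" and u: "is_section T N u" and p: "1 \<le> p"
    and g: "upper_gradient p T N u g"
  obtains E where "E \<subseteq> einterval 0 T" "AE t in lborel. t \<in> einterval 0 T \<longrightarrow> t \<in> E"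
    "majorant E (incr N u) g"
proof -
  let ?I = "einterval 0 T"
  let ?Q = "\<lambda>s t. s \<in> ?I \<longrightarrow> t \<in> ?I \<longrightarrow> s \<le> t \<longrightarrow> incr N u s t \<le> (LINT \<tau>:{s..t}|lebesgue. g \<tau>)"
  have "AE x in lebesgue. ?Q (fst x) (snd x)"
    using g unfolding upper_gradient_def incr_def by (simp add: case_prod_unfold)
  then have "AE x in lborel \<Otimes>\<^sub>M lborel. ?Q (fst x) (snd x)"
    by (simp only: lborel_prod AE_completion_iff)
  then obtain Z where Z: "{x \<in> space (lborel \<Otimes>\<^sub>M lborel). \<not> ?Q (fst x) (snd x)} \<subseteq> Z"
    "emeasure (lborel \<Otimes>\<^sub>M lborel) Z = 0" "Z \<in> sets (lborel \<Otimes>\<^sub>M lborel)"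
    by (rule AE_E)
  have Q: "?Q s t" if "(s, t) \<notin> Z" for s t
    using subsetD[OF Z(1), of "(s, t)"] that by (auto simp: space_pair_measure)
  have AEZ: "AE x in lborel \<Otimes>\<^sub>M lborel. x \<notin> Z"
    using Z(2,3) by (intro AE_not_in) auto
  have ae1: "AE s in lborel. AE t in lborel. (s, t) \<notin> Z"
    using lborel_pair.AE_pair[OF AEZ] .
  have "{x \<in> space (lborel \<Otimes>\<^sub>M lborel). (fst x, snd x) \<notin> Z} \<in> sets (lborel \<Otimes>\<^sub>M lborel)"
  proof -
    have "{x \<in> space (lborel \<Otimes>\<^sub>M lborel). (fst x, snd x) \<notin> Z} = space (lborel \<Otimes>\<^sub>M lborel) - Z"
      by auto
    then show ?thesis using Z(3) by (metis sets.compl_sets)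
  qed
  then have ae2: "AE t in lborel. AE s in lborel. (s, t) \<notin> Z"
    using lborel_pair.AE_commute[of "\<lambda>s t. (s, t) \<notin> Z"] ae1 by simp
  define E where "E = {t \<in> ?I. (AE r in lborel. (t, r) \<notin> Z) \<and> (AE r in lborel. (r, t) \<notin> Z)}"
  show ?thesis
  proof
    show "E \<subseteq> ?I" by (auto simp: E_def)
    show "AE t in lborel. t \<in> ?I \<longrightarrow> t \<in> E"
      using ae1 ae2 by eventually_elim (auto simp: E_def)
    show "majorant E (incr N u) g"
      unfolding majorant_def
    proof (intro ballI impI conjI)
      fix s t assume st: "s \<in> E" "t \<in> E" "s \<le> t"
      then have I: "s \<in> ?I" "t \<in> ?I" by (auto simp: E_def)
      have int: "set_integrable lebesgue {a..b} g" if "a \<in> ?I" "b \<in> ?I" for a b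
        using Lp_set_integrable[OF p _ that] g by (auto simp: upper_gradient_def)
      show "set_integrable lebesgue {s..t} g" by (rule int[OF I])
      show "incr N u s t \<le> (LINT \<tau>:{s..t}|lebesgue. g \<tau>)"
      proof (cases "s = t")
        case True
        then show ?thesis using incr_eq_0[OF mf u I st(3)] set_integral_singleton[of t g] by simp
      next
        case False
        have "AE r in lborel. (s, r) \<notin> Z \<and> (r, t) \<notin> Z" using st by (auto simp: E_def)
        then obtain r where r: "s < r" "r < t" "(s, r) \<notin> Z" "(r, t) \<notin> Z"
          using AE_lborel_ex_between[of _ s t] False st(3) by fastforce
        then have rI: "r \<in> ?I" using Icc_subset_einterval[OF I] by auto
        have "incr N u s t \<le> incr N u s r + incr N u r t"
          using r by (intro incr_triangle[OF mf u] I rI) auto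
        also have "\<dots> \<le> (LINT \<tau>:{s..r}|lebesgue. g \<tau>) + (LINT \<tau>:{r..t}|lebesgue. g \<tau>)"
          using Q[OF r(3)] Q[OF r(4)] r I rI by auto
        also have "\<dots> = (LINT \<tau>:{s..t}|lebesgue. g \<tau>)"
          using set_integral_split[OF _ _ int[OF I(1) rI] int[OF rI I(2)]] r by simp
        finally show ?thesis .
      qed
    qed
  qed
qed

lemma majorant_upper_gradient:
  assumes E: "AE t in lborel. t \<in> einterval 0 T \<longrightarrow> t \<in> E"
    and maj: "majorant E (incr N u) g" and g: "g \<in> Lp p (leb T)"
  shows "upper_gradient p T N u g"
proof -
  let ?I = "einterval 0 T"
  obtain Z where Z: "{t \<in> space lborel. \<not> (t \<in> ?I \<longrightarrow> t \<in> E)} \<subseteq> Z"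
    "emeasure lborel Z = 0" "Z \<in> sets lborel"
    using E by (rule AE_E)
  have "AE t in lborel. t \<notin> Z" using Z(2,3) by (intro AE_not_in) auto
  then have "AE s in lborel. AE t in lborel. s \<notin> Z \<and> t \<notin> Z"
    by (auto elim!: eventually_mono)
  moreover have "{x \<in> space (lborel \<Otimes>\<^sub>M lborel). fst x \<notin> Z \<and> snd x \<notin> Z} = (- Z) \<times> (- Z)"
    by (auto simp: space_pair_measure)
  moreover have "(- Z) \<times> (- Z) \<in> sets (lborel \<Otimes>\<^sub>M lborel)"
    using sets.compl_sets[OF Z(3)] by (intro pair_measureI) (auto simp: Compl_eq_Diff_UNIV)
  ultimately have "AE x in lborel \<Otimes>\<^sub>M lborel. fst x \<notin> Z \<and> snd x \<notin> Z"
    by (intro lborel_pair.AE_pair_measure) simp_all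
  then have "AE x in lebesgue. fst x \<notin> Z \<and> snd x \<notin> Z"
    by (simp only: lborel_prod AE_completion_iff)
  then have "AE x in lebesgue. fst x \<in> ?I \<longrightarrow> snd x \<in> ?I \<longrightarrow> fst x \<le> snd x \<longrightarrow>
      incr N u (fst x) (snd x) \<le> (LINT \<tau>:{fst x..snd x}|lebesgue. g \<tau>)"
  proof eventually_elim
    case (elim x)
    then have "fst x \<in> ?I \<longrightarrow> fst x \<in> E" "snd x \<in> ?I \<longrightarrow> snd x \<in> E" using Z(1) by auto
    then show ?case using majorantD(2)[OF maj, of "fst x" "snd x"] by auto
  qed
  then show ?thesis
    using g unfolding upper_gradient_def incr_def by (simp add: case_prod_unfold)
qed

section \<open>Sections with prescribed norm\<close>

definition step_fun :: "ereal \<Rightarrow> (real \<Rightarrow> 'v::real_vector) \<Rightarrow> bool" where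
  "step_fun T f \<longleftrightarrow> (\<exists>n (A :: nat \<Rightarrow> real set) v.
     (\<forall>k\<in>{1..n}. A k \<in> sets (leb T)) \<and>
     (\<forall>t\<in>einterval 0 T. f t = (\<Sum>k=1..n. indicator (A k) t *\<^sub>R v k)))"

lemma simple_section_const_class:
  "step_fun T f \<Longrightarrow> simple_section T N (\<lambda>t. const_class (N t) (f t))"
  unfolding step_fun_def simple_section_def by metis

lemma step_fun_0: "step_fun T (\<lambda>t. 0)"
  unfolding step_fun_def by (rule exI[of _ 0]) simp

lemma step_fun_add_indicator:
  assumes "step_fun T f" "B \<in> sets (leb T)"
  shows "step_fun T (\<lambda>t. f t + indicator B t *\<^sub>R w)"
proof -
  obtain n A v where A: "\<forall>k\<in>{1..n}. A k \<in> sets (leb T)"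
    and f: "\<forall>t\<in>einterval 0 T. f t = (\<Sum>k=1..n::nat. indicator (A k) t *\<^sub>R v k)"
    using assms(1) unfolding step_fun_def by blast
  have "(\<Sum>k=1..Suc n. indicator ((A(Suc n := B)) k) t *\<^sub>R (v(Suc n := w)) k) =
      (\<Sum>k=1..n. indicator (A k) t *\<^sub>R v k) + indicator B t *\<^sub>R w" for t
  proof -
    have "(\<Sum>k=1..n. indicator ((A(Suc n := B)) k) t *\<^sub>R (v(Suc n := w)) k) =
        (\<Sum>k=1..n. indicator (A k) t *\<^sub>R v k)"
      by (rule sum.cong) auto
    then show ?thesis by simp
  qed
  with f have "\<forall>t\<in>einterval 0 T. f t + indicator B t *\<^sub>R w =
      (\<Sum>k=1..Suc n. indicator ((A(Suc n := B)) k) t *\<^sub>R (v(Suc n := w)) k)"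
    by simp
  moreover have "\<forall>k\<in>{1..Suc n}. (A(Suc n := B)) k \<in> sets (leb T)"
    using A assms(2) by auto
  ultimately show ?thesis unfolding step_fun_def by blast
qed

lemma step_fun_add_simple_function:
  assumes f: "step_fun T f" and s: "simple_function (leb T) s"
  shows "step_fun T (\<lambda>t. f t + s t *\<^sub>R b)"
proof -
  let ?I = "einterval 0 T" and ?B = "\<lambda>y. s -` {y} \<inter> einterval 0 T"
  have "step_fun T (\<lambda>t. f t + (\<Sum>y\<in>Y. indicator (?B y) t *\<^sub>R (y *\<^sub>R b)))" if "finite Y" for Y
    using that
  proof induction
    case empty
    then show ?case using f by simp
  next
    case (insert y Y)
    have "?B y \<in> sets (leb T)"
      using simple_functionD(2)[OF s, of "{y}"] by (simp add: space_leb)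
    from step_fun_add_indicator[OF insert.IH this, of "y *\<^sub>R b"] insert.hyps
    show ?case by (simp add: algebra_simps)
  qed
  then have "step_fun T (\<lambda>t. f t + (\<Sum>y\<in>s ` ?I. indicator (?B y) t *\<^sub>R (y *\<^sub>R b)))"
    using simple_functionD(1)[OF s] by (simp add: space_leb)
  moreover have "(\<Sum>y\<in>s ` ?I. indicator (?B y) t *\<^sub>R (y *\<^sub>R b)) = s t *\<^sub>R b" if "t \<in> ?I" for t
  proof -
    have "(\<Sum>y\<in>s ` ?I. indicator (?B y) t *\<^sub>R (y *\<^sub>R b)) = (\<Sum>y\<in>s ` ?I. if y = s t then y *\<^sub>R b else 0)"
      using that by (intro sum.cong) (auto simp: indicator_def)
    also have "\<dots> = s t *\<^sub>R b"
      using that simple_functionD(1)[OF s] by (simp add: space_leb)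
    finally show ?thesis .
  qed
  ultimately show ?thesis unfolding step_fun_def by simp
qed

lemma step_fun_sum_simple_functions:
  assumes "\<And>n::nat. simple_function (leb T) (s n)"
  shows "step_fun T (\<lambda>t. \<Sum>n<k. s n t *\<^sub>R b n)"
  by (induction k) (simp_all add: step_fun_0 step_fun_add_simple_function assms)

lemma measurable_section_const_class:
  fixes c :: "nat \<Rightarrow> real \<Rightarrow> real"
  assumes mf: "monotone_family T N"
    and c: "\<And>n. c n \<in> borel_measurable (leb T)"
    and c0: "\<And>n t. t \<in> einterval 0 T \<Longrightarrow> n \<noteq> m t \<Longrightarrow> c n t = 0"
  shows "measurable_section T N (\<lambda>t. const_class (N t) (c (m t) t *\<^sub>R b (m t)))"
proof -
  let ?I = "einterval 0 T"
  have "\<exists>s. \<forall>n. (\<forall>k. simple_function (leb T) (s n k)) \<and>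
      (\<forall>t\<in>?I. (\<lambda>k. s n k t) \<longlonglongrightarrow> c n t) \<and> (\<forall>k. \<forall>t\<in>?I. \<bar>s n k t\<bar> \<le> 2 * \<bar>c n t\<bar>)"
    using borel_measurable_implies_sequence_metric[OF c, where z=0]
    by (intro choice allI) (simp add: space_leb dist_norm)
  then obtain s where s: "\<And>n k. simple_function (leb T) (s n k)"
      "\<And>n t. t \<in> ?I \<Longrightarrow> (\<lambda>k. s n k t) \<longlonglongrightarrow> c n t"
      "\<And>n k t. t \<in> ?I \<Longrightarrow> \<bar>s n k t\<bar> \<le> 2 * \<bar>c n t\<bar>"
    by blast
  define F where "F k t = (\<Sum>n<k. s n k t *\<^sub>R b n)" for k t
  have "simple_section T N (\<lambda>t. const_class (N t) (F k t))" for k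
    unfolding F_def by (intro simple_section_const_class step_fun_sum_simple_functions s)
  moreover have "(\<lambda>k. nrm (Xsp N t) (nsub (Xsp N t) (const_class (N t) (F k t))
      (const_class (N t) (c (m t) t *\<^sub>R b (m t))))) \<longlonglongrightarrow> 0" if t: "t \<in> ?I" for t
  proof -
    note Nt = monotone_familyD(1)[OF mf t]
    have F: "F k t = s (m t) k t *\<^sub>R b (m t)" if "m t < k" for k
    proof -
      have "s n k t = 0" if "n \<noteq> m t" for n
        using s(3)[OF t, of n k] c0[OF t that] by simp
      then have "F k t = (\<Sum>n<k. if n = m t then s n k t *\<^sub>R b n else 0)"
        unfolding F_def by (intro sum.cong) auto
      then show ?thesis using that by simp
    qed
    have "(\<lambda>k. \<bar>s (m t) k t - c (m t) t\<bar> * N t (b (m t))) \<longlonglongrightarrow> \<bar>c (m t) t - c (m t) t\<bar> * N t (b (m t))"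
      by (intro tendsto_intros s(2)[OF t])
    moreover have "\<forall>\<^sub>F k in sequentially. \<bar>s (m t) k t - c (m t) t\<bar> * N t (b (m t)) =
        N t (F k t - c (m t) t *\<^sub>R b (m t))"
      using eventually_gt_at_top[of "m t"]
      by eventually_elim (simp add: F seminormD(3)[OF Nt] flip: scaleR_diff_left)
    ultimately have "(\<lambda>k. N t (F k t - c (m t) t *\<^sub>R b (m t))) \<longlonglongrightarrow> 0"
      by (simp add: tendsto_cong)
    then show ?thesis by (simp add: nsub_const_class[OF Nt] nrm_const_class[OF Nt])
  qed
  then have "AE t in leb T. (\<lambda>k. nrm (Xsp N t) (nsub (Xsp N t) (const_class (N t) (F k t))
      (const_class (N t) (c (m t) t *\<^sub>R b (m t))))) \<longlonglongrightarrow> 0"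
    by (intro AE_I2) (simp add: space_leb)
  moreover have "is_section T N (\<lambda>t. const_class (N t) (c (m t) t *\<^sub>R b (m t)))"
    unfolding is_section_def const_class_eq_cls
    by (intro ballI cls_points Cauchy_seqs_const monotone_familyD(1)[OF mf])
  ultimately show ?thesis
    unfolding measurable_section_def by (intro conjI exI[of _ "\<lambda>k t. const_class (N t) (F k t)"]) blast+
qed

lemma seminorm_measurable:
  assumes mf: "monotone_family T N"
  shows "(\<lambda>t. N t v) \<in> borel_measurable (leb T)"
proof -
  let ?I = "einterval 0 T"
  have "mono_on ?I (\<lambda>t. - N t v)"
    using monotone_familyD(2)[OF mf] by (auto simp: monotone_on_def)
  then have "(\<lambda>t. - N t v) \<in> borel_measurable (restrict_space borel ?I)"
    by (rule borel_measurable_mono_on_fnc)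
  then have "(\<lambda>t. - N t v) \<in> borel_measurable (leb T)"
    unfolding leb_def by (simp add: borel_measurable_restrict_space_iff measurable_completion)
  then have "(\<lambda>t. - (- N t v)) \<in> borel_measurable (leb T)"
    by (rule borel_measurable_uminus)
  then show ?thesis by simp
qed

text \<open>
  Countably many vectors detect where the seminorms vanish: for rational \<open>q\<close> choose a vector with
  positive \<open>N q\<close>-norm, which by monotonicity has positive \<open>N t\<close>-norm for all \<open>t \<le> q\<close>. Only a largest
  \<open>t\<close> with \<open>N t \<noteq> 0\<close> can be missed.
\<close>

lemma ex_countable_nonvanishing:
  assumes mf: "monotone_family T N"
  obtains b :: "nat \<Rightarrow> 'v::real_vector" where
    "AE t in lborel. t \<in> einterval 0 T \<longrightarrow> (\<exists>n. N t (b n) \<noteq> 0) \<or> (\<forall>v. N t v = 0)"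
proof -
  let ?I = "einterval 0 T"
  define q where "q n = real_of_rat (nat_to_rat_surj n)" for n
  define b where "b n = (SOME v. N (q n) v \<noteq> 0)" for n
  define Z where "Z = {t \<in> ?I. (\<exists>v. N t v \<noteq> 0) \<and> (\<forall>n. N t (b n) = 0)}"
  have no_less: "\<not> s < t" if st: "s \<in> Z" "t \<in> Z" for s t
  proof
    assume "s < t"
    then obtain r where r: "s < real_of_rat r" "real_of_rat r < t"
      using of_rat_dense by blast
    obtain n where n: "r = nat_to_rat_surj n" using surj_nat_to_rat_surj by blast
    have I: "s \<in> ?I" "t \<in> ?I" using st by (auto simp: Z_def)
    have q: "s < q n" "q n < t" using r n by (simp_all add: q_def)
    then have qI: "q n \<in> ?I" using Icc_subset_einterval[OF I] by auto
    obtain v where "N t v \<noteq> 0" using st(2) by (auto simp: Z_def)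
    then have "0 < N t v" using seminormD(1)[OF monotone_familyD(1)[OF mf I(2)], of v] by simp
    then have "N (q n) v \<noteq> 0" using monotone_familyD(2)[OF mf qI I(2), of v] q by simp
    then have "N (q n) (b n) \<noteq> 0" unfolding b_def by (rule someI)
    then have "0 < N (q n) (b n)" using seminormD(1)[OF monotone_familyD(1)[OF mf qI], of "b n"] by simp
    then have "N s (b n) \<noteq> 0" using monotone_familyD(2)[OF mf I(1) qI, of "b n"] q by simp
    then show False using st(1) by (simp add: Z_def)
  qed
  have "\<exists>z. Z \<subseteq> {z}" using no_less by (metis insertI1 linorder_neqE subsetI)
  then obtain z where z: "Z \<subseteq> {z}" ..
  have "AE t in lborel. t \<noteq> z" by (rule AE_lborel_singleton)
  then have "AE t in lborel. t \<in> ?I \<longrightarrow> (\<exists>n. N t (b n) \<noteq> 0) \<or> (\<forall>v. N t v = 0)"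
    by eventually_elim (use z in \<open>auto simp: Z_def\<close>)
  then show ?thesis by (rule that)
qed

lemma ex_section_with_norm:
  assumes mf: "monotone_family T N"
    and h: "h \<in> borel_measurable (leb T)" "\<And>t. 0 \<le> h t"
  obtains v where "measurable_section T N v"
    "\<And>t. t \<in> einterval 0 T \<Longrightarrow> nrm (Xsp N t) (v t) = (if \<exists>n::nat. N t (b n) \<noteq> 0 then h t else 0)"
proof -
  let ?I = "einterval 0 T"
  define m where "m t = (LEAST n. N t (b n) \<noteq> 0)" for t
  define c where "c n t = (if N t (b n) \<noteq> 0 \<and> (\<forall>i<n. N t (b i) = 0) then h t / N t (b n) else 0)" for n t
  have [measurable]: "(\<lambda>t. N t (b n)) \<in> borel_measurable (leb T)" for n
    by (rule seminorm_measurable[OF mf])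
  note [measurable] = h(1)
  have c: "c n \<in> borel_measurable (leb T)" for n
    unfolding c_def by measurable
  have c0: "c n t = 0" if "n \<noteq> m t" for n t
  proof (rule ccontr)
    assume "c n t \<noteq> 0"
    then have *: "N t (b n) \<noteq> 0" "\<forall>i<n. N t (b i) = 0" by (auto simp: c_def split: if_splits)
    then have "m t = n" unfolding m_def by (intro Least_equality) (auto simp: not_less[symmetric])
    with that show False by simp
  qed
  let ?v = "\<lambda>t. const_class (N t) (c (m t) t *\<^sub>R b (m t))"
  show ?thesis
  proof
    show "measurable_section T N ?v"
      by (rule measurable_section_const_class[OF mf c c0])
    fix t assume t: "t \<in> ?I"
    note Nt = monotone_familyD(1)[OF mf t]
    have "nrm (Xsp N t) (?v t) = \<bar>c (m t) t\<bar> * N t (b (m t))"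
      by (simp add: nrm_const_class[OF Nt] seminormD(3)[OF Nt])
    also have "\<dots> = (if \<exists>n. N t (b n) \<noteq> 0 then h t else 0)"
    proof (cases "\<exists>n. N t (b n) \<noteq> 0")
      case True
      then have "N t (b (m t)) \<noteq> 0" unfolding m_def by (rule LeastI_ex)
      moreover have "\<forall>i<m t. N t (b i) = 0" unfolding m_def using not_less_Least by blast
      moreover have "0 \<le> N t (b (m t))" by (rule seminormD(1)[OF Nt])
      ultimately show ?thesis using True h(2)[of t] by (simp add: c_def abs_of_nonneg)
    next
      case False
      then show ?thesis by simp
    qed
    finally show "nrm (Xsp N t) (?v t) = (if \<exists>n. N t (b n) \<noteq> 0 then h t else 0)" .
  qed
qed

section \<open>The minimal upper gradient\<close>

lemma dense_subadditive_incr: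
  assumes mf: "monotone_family T N" and u: "is_section T N u"
    and E: "E \<subseteq> einterval 0 T" "AE t in lborel. t \<in> einterval 0 T \<longrightarrow> t \<in> E"
  shows "dense_subadditive E (incr N u)"
proof
  fix s t r assume "s \<in> E" "t \<in> E" "r \<in> E" "s \<le> t" "t \<le> r"
  then show "incr N u s r \<le> incr N u s t + incr N u t r"
    using E(1) by (intro incr_triangle[OF mf u]) auto
next
  fix s t a b assume st: "s \<in> E" "t \<in> E" "s \<le> a" "a < b" "b \<le> t"
  obtain r where r: "a < r" "r < b" "r \<in> einterval 0 T \<longrightarrow> r \<in> E"
    using AE_lborel_ex_between[OF E(2) st(4)] by blast
  moreover have "r \<in> einterval 0 T"
    using Icc_subset_einterval[OF subsetD[OF E(1) st(1)] subsetD[OF E(1) st(2)]] st(3-5) r(1,2)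
    by (auto simp: subset_iff)
  ultimately show "\<exists>r\<in>E. a < r \<and> r < b" by blast
qed

lemma majorant_mono:
  assumes f: "majorant E d f" and int: "\<And>s t. s \<in> E \<Longrightarrow> t \<in> E \<Longrightarrow> s \<le> t \<Longrightarrow> set_integrable lebesgue {s..t} g"
    and le: "\<And>s t x. s \<in> E \<Longrightarrow> t \<in> E \<Longrightarrow> s \<le> x \<Longrightarrow> x \<le> t \<Longrightarrow> f x \<le> g x"
  shows "majorant E d g"
  unfolding majorant_def
proof (intro ballI impI conjI int)
  fix s t assume st: "s \<in> E" "t \<in> E" "s \<le> t"
  have "(LINT x:{s..t}|lebesgue. f x) \<le> (LINT x:{s..t}|lebesgue. g x)"
    using st le by (intro set_integral_mono majorantD(1)[OF f] int) auto
  then show "d s t \<le> (LINT x:{s..t}|lebesgue. g x)"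
    using majorantD(2)[OF f st] by simp
qed

lemma ex_minimal_section:
  fixes N :: "real \<Rightarrow> 'v::real_vector \<Rightarrow> real" and g :: "nat \<Rightarrow> real \<Rightarrow> real"
  assumes T: "0 < T" and p: "1 \<le> p" and mf: "monotone_family T N" and u: "is_section T N u"
    and g: "\<And>n. upper_gradient p T N u (g n)"
  obtains v where "v \<in> Lp_sections p T N" "upper_gradient p T N u (\<lambda>t. nrm (Xsp N t) (v t))"
    "\<And>n. Lp_section_norm p T N v \<le> Lp_norm p (leb T) (g n)"
proof -
  let ?I = "einterval 0 T"
  note M = emeasure_leb_neq_0[OF T]
  have gLp: "g n \<in> Lp p (leb T)" for n using g[of n] by (simp add: upper_gradient_def)
  have "\<exists>E. \<forall>n. E n \<subseteq> ?I \<and> (AE t in lborel. t \<in> ?I \<longrightarrow> t \<in> E n) \<and> majorant (E n) (incr N u) (g n)"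
    by (intro choice allI) (use upper_gradient_majorant[OF mf u p g] in metis)
  then obtain E where E: "\<And>n. E n \<subseteq> ?I" "\<And>n. AE t in lborel. t \<in> ?I \<longrightarrow> t \<in> E n"
      "\<And>n. majorant (E n) (incr N u) (g n)"
    by blast
  obtain b :: "nat \<Rightarrow> 'v" where
    b: "AE t in lborel. t \<in> ?I \<longrightarrow> (\<exists>n. N t (b n) \<noteq> 0) \<or> (\<forall>v. N t v = 0)"
    using ex_countable_nonvanishing[OF mf] .
  define D where "D = {t \<in> (\<Inter>n. E n). (\<exists>n. N t (b n) \<noteq> 0) \<or> (\<forall>v. N t v = 0)}"
  have DI: "D \<subseteq> ?I" using E(1) by (auto simp: D_def)
  have "AE t in lborel. \<forall>n. t \<in> ?I \<longrightarrow> t \<in> E n"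
    unfolding AE_all_countable using E(2) by blast
  then have D_ae: "AE t in lborel. t \<in> ?I \<longrightarrow> t \<in> D"
    using b by eventually_elim (auto simp: D_def)
  interpret dense_subadditive D "incr N u"
    by (rule dense_subadditive_incr[OF mf u DI D_ae])

  define g' where "g' n t = (if t \<in> ?I then max (g n t) 0 else 0)" for n t
  have g'_leb: "(\<lambda>t. max (g n t) 0) \<in> borel_measurable (leb T)" for n
    using gLp[of n] by (intro borel_measurable_max) (simp_all add: Lp_def)
  have g'_meas: "g' n \<in> borel_measurable lebesgue" for n
  proof -
    have "(\<lambda>t. indicator ?I t *\<^sub>R max (g n t) 0) \<in> borel_measurable lebesgue"
      using g'_leb[of n] unfolding leb_def by (subst (asm) borel_measurable_restrict_space_iff) auto
    also have "(\<lambda>t. indicator ?I t *\<^sub>R max (g n t) 0) = g' n"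
      by (auto simp: g'_def indicator_def)
    finally show ?thesis .
  qed
  have g'_int: "set_integrable lebesgue {s..t} (g' n)" if "s \<in> D" "t \<in> D" "s \<le> t" for s t n
  proof -
    have "(\<lambda>t. max (g n t) 0) \<in> Lp p (leb T)"
      by (rule Lp_mono(1)[OF p M g'_leb gLp[of n]]) auto
    then have "set_integrable lebesgue {s..t} (\<lambda>t. max (g n t) 0)"
      using that DI by (intro Lp_set_integrable[OF p]) auto
    moreover have "{s..t} \<subseteq> ?I" using that DI by (intro Icc_subset_einterval) auto
    ultimately show ?thesis by (subst set_integrable_cong[OF refl refl]) (auto simp: g'_def)
  qed
  have g'_maj: "majorant D (incr N u) (g' n)" for n
  proof (rule majorant_mono[OF _ g'_int])
    show "majorant D (incr N u) (g n)"
      using E(3)[of n] by (auto simp: majorant_def D_def)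
    fix s t x assume st: "s \<in> D" "t \<in> D" "s \<le> x" "x \<le> t"
    then have "x \<in> ?I"
      using Icc_subset_einterval[OF subsetD[OF DI st(1)] subsetD[OF DI st(2)]] by (simp add: subset_iff)
    then show "g n x \<le> g' n x" by (simp add: g'_def)
  qed auto
  have g'_nonneg: "0 \<le> g' n x" for n x by (simp add: g'_def)
  obtain h where h: "majorant D (incr N u) h" "h \<in> borel_measurable lebesgue"
    "\<And>n x. h x \<le> g' n x" "\<And>x. 0 \<le> h x"
    using majorant_INF[where g = g', OF g'_maj g'_meas g'_nonneg] by blast
  have h_leb: "h \<in> borel_measurable (leb T)"
    unfolding leb_def by (rule measurable_restrict_space1[OF h(2)])

  obtain v where v: "measurable_section T N v"
    "\<And>t. t \<in> ?I \<Longrightarrow> nrm (Xsp N t) (v t) = (if \<exists>n. N t (b n) \<noteq> 0 then h t else 0)"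
    using ex_section_with_norm[where b = b, OF mf h_leb h(4)] by blast
  let ?w = "\<lambda>t. nrm (Xsp N t) (v t)"
  have w_meas: "?w \<in> borel_measurable (leb T)"
  proof -
    note [measurable] = seminorm_measurable[OF mf] h_leb
    have "(\<lambda>t. if \<exists>n. N t (b n) \<noteq> 0 then h t else 0) \<in> borel_measurable (leb T)"
      by measurable
    then show ?thesis
      by (subst measurable_cong[of _ _ "\<lambda>t. if \<exists>n. N t (b n) \<noteq> 0 then h t else 0"])
        (simp_all add: space_leb v(2))
  qed
  have w_le: "\<bar>?w t\<bar> \<le> \<bar>g n t\<bar>" if "t \<in> space (leb T)" for n t
    using that h(3)[of t n] h(4)[of t] by (auto simp: space_leb v(2) g'_def)
  note w_Lp = Lp_mono[OF p M w_meas gLp w_le]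
  have "majorant D (incr N u) ?w"
    unfolding majorant_def
  proof (intro ballI impI conjI)
    fix s t assume st: "s \<in> D" "t \<in> D" "s \<le> t"
    then have I: "s \<in> ?I" "t \<in> ?I" using DI by auto
    note sub = Icc_subset_einterval[OF I]
    show "set_integrable lebesgue {s..t} ?w" by (rule Lp_set_integrable[OF p w_Lp(1) I])
    show "incr N u s t \<le> (LINT x:{s..t}|lebesgue. ?w x)"
    proof (cases "\<exists>n. N t (b n) \<noteq> 0")
      case True
      then obtain n where n: "N t (b n) \<noteq> 0" by blast
      have "?w x = h x" if x: "x \<in> {s..t}" for x
      proof -
        have xI: "x \<in> ?I" using x sub by blast
        have "N x (b n) \<noteq> 0"
          using n x monotone_familyD(2)[OF mf xI I(2), of "b n"]
            seminormD(1)[OF monotone_familyD(1)[OF mf I(2)], of "b n"] by auto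
        then show ?thesis using v(2)[OF xI] by auto
      qed
      then have "(LINT x:{s..t}|lebesgue. ?w x) = (LINT x:{s..t}|lebesgue. h x)"
        by (intro set_lebesgue_integral_cong) auto
      then show ?thesis using majorantD(2)[OF h(1) st] by simp
    next
      case False
      then have "incr N u s t = 0"
        using st(2) by (intro incr_eq_0[OF mf u I st(3)]) (auto simp: D_def)
      also have "\<dots> \<le> (LINT x:{s..t}|lebesgue. ?w x)"
        unfolding set_lebesgue_integral_def
      proof (rule Bochner_Integration.integral_nonneg)
        fix x
        show "0 \<le> indicator {s..t} x *\<^sub>R ?w x"
          using sub h(4)[of x] v(2)[of x] by (auto simp: indicator_def)
      qed
      finally show ?thesis .
    qed
  qed
  then have "upper_gradient p T N u ?w"
    by (rule majorant_upper_gradient[OF D_ae _ w_Lp(1)])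
  then show ?thesis
    using v(1) w_Lp by (intro that[of v]) (auto simp: Lp_sections_def Lp_section_norm_def)
qed

theorem theorem4p5:
  fixes p T :: ereal and N :: "real \<Rightarrow> 'v::real_vector \<Rightarrow> real"
    and u :: "real \<Rightarrow> (nat \<Rightarrow> 'v) set"
  assumes "0 < T" and "1 \<le> p"
    and "monotone_family T N"
    and "\<And>t. t \<in> einterval 0 T \<Longrightarrow> reflexive (Xsp N t)"
    and "u \<in> W1p p T N"
  shows "\<exists>v \<in> Lp_sections p T N.
    upper_gradient p T N u (\<lambda>t. nrm (Xsp N t) (v t)) \<and>
    Lp_section_norm p T N v = (INF g \<in> {g. upper_gradient p T N u g}. Lp_norm p (leb T) g)"
proof -
  let ?G = "{g. upper_gradient p T N u g}" and ?L = "Lp_norm p (leb T)"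
  let ?\<alpha> = "INF g\<in>?G. ?L g"
  have u: "is_section T N u" and ne: "?G \<noteq> {}"
    using assms(5) by (auto simp: W1p_def Lp_sections_def measurable_section_def)
  have bdd: "bdd_below (?L ` ?G)"
    by (rule bdd_belowI[of _ 0])
      (auto simp: upper_gradient_def Lp_def intro!: Lp_norm_nonneg emeasure_leb_neq_0[OF assms(1)])
  have "\<exists>g. upper_gradient p T N u g \<and> ?L g < ?\<alpha> + 1 / Suc n" for n
    using cInf_lessD[of "?L ` ?G" "?\<alpha> + 1 / Suc n"] ne by auto
  then obtain g where g: "\<And>n. upper_gradient p T N u (g n)" "\<And>n. ?L (g n) < ?\<alpha> + 1 / Suc n"
    by metis
  obtain v where v: "v \<in> Lp_sections p T N" "upper_gradient p T N u (\<lambda>t. nrm (Xsp N t) (v t))"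
    "\<And>n. Lp_section_norm p T N v \<le> ?L (g n)"
    using ex_minimal_section[where g = g, OF assms(1,2,3) u g(1)] by blast
  have "(\<lambda>n. ?\<alpha> + 1 / Suc n) \<longlonglongrightarrow> ?\<alpha>"
    using tendsto_add[OF tendsto_const LIMSEQ_inverse_real_of_nat, of ?\<alpha>]
    by (simp add: inverse_eq_divide)
  then have "Lp_section_norm p T N v \<le> ?\<alpha>"
    using order_trans[OF v(3) less_imp_le[OF g(2)]] by (intro LIMSEQ_le_const) auto
  moreover have "?\<alpha> \<le> Lp_section_norm p T N v"
    unfolding Lp_section_norm_def using v(2) by (intro cINF_lower[OF bdd]) simp
  ultimately show ?thesis using v(1,2) by (intro bexI[of _ v]) auto
qed

end
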